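(* Let $g>0$. There exist constants $0<c\le C$ depending only on $g$ such that the following holds. For every $\delta$ with $0<\delta<\frac{g}{4}$ there exist a function $f\in C^1(\mathbb{R}/\mathbb{Z})$, an initial condition $(t_0^*,v_0^* )$, an integer $N\ge 1$ with $\frac{c}{\delta}\le N\le \frac{C}{\delta}$, and an integer $V\in\mathbb{N}\setminus\{0\}$ such that: 1. $\|\dot f\|_{C^0[0,1]}=\sup_{t\in[0,1]}|\dot f(t)|\le\delta$; 2. the orbit $(t_n^*,v_n^* )_{n\in\mathbb{N}}$ of $P_f$ with initial condition $(t_0^*,v_0^* )$ is defined for all $n\in\mathbb{N}$ and satisfies, for every $n\in\mathbb{N}$, $$t_{n+N}^*=t_n^*+\sigma_n\ \text{ for some }\sigma_n\in\mathbb{N},\qquad v_{n+N}^*=v_n^*+\frac{g}{2}V .$$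
   Context: $\mathbb{N}$ denotes the non-negative integers (including $0$). $g>0$ is a fixed constant (the gravitational acceleration). $C^1(\mathbb{R}/\mathbb{Z})$ is the set of $1$-periodic $C^1$ functions $f:\mathbb{R}\to\mathbb{R}$, and $\dot f$ is the derivative. For $t\neq s$ put $f[t,s]=\frac{f(t)-f(s)}{t-s}$. The map $P_f:(t_0,v_0)\mapsto(t_1,v_1)$ (impact time and velocity immediately after impact of a ball bouncing elastically on a plate moving vertically as $f$) is defined implicitly by $$t_1=t_0+\frac{2}{g}v_0-\frac{2}{g}f[t_1,t_0],\qquad v_1=v_0+2\dot f(t_1)-2f[t_1,t_0].$$ There is a sufficiently large constant $\bar v=\bar v(f)>0$ such that for every $t_0\in\mathbb{R}$ and $v_0>\bar v$ the first equation has a unique solution $t_1>t_0$, so that $P_f$ is well defined on $\{v>\bar v\}$; such a $\bar v$ is fixed for each $f$. An orbit of $P_f$ is a sequence $(t_n,v_n)_{n\in\mathbb{N}}$ in $\mathbb{R}\times(\bar v,+\infty)$ (times are lifted to $\mathbb{R}$) with $(t_{n+1},v_{n+1})=P_f(t_n,v_n)$ for all $n$. *)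

theory Defs
  imports "HOL-Analysis.Analysis"
begin

definition C1_periodic :: "(real \<Rightarrow> real) set" where
  "C1_periodic = {f. (\<forall>x. f (x + 1) = f x) \<and> f C1_differentiable_on UNIV}"

text \<open>Only used for \<open>t \<noteq> s\<close>.\<close>

definition divdiff :: "(real \<Rightarrow> real) \<Rightarrow> real \<Rightarrow> real \<Rightarrow> real" where
  "divdiff f t s = (f t - f s) / (t - s)"

definition next_impact :: "real \<Rightarrow> (real \<Rightarrow> real) \<Rightarrow> real \<Rightarrow> real \<Rightarrow> real \<Rightarrow> bool" where
  "next_impact g f t0 v0 t1 \<longleftrightarrow>
     t1 > t0 \<and> t1 = t0 + (2 / g) * v0 - (2 / g) * divdiff f t1 t0"

text \<open>The constants that may serve as the velocity threshold of \<open>f\<close>: above them the next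
  impact time exists and is unique. They form an upward closed set, which is
  nonempty for \<open>g > 0\<close> and \<open>f \<in> C1_periodic\<close> (\<open>ex_velocity_threshold\<close> below).\<close>

definition velocity_threshold :: "real \<Rightarrow> (real \<Rightarrow> real) \<Rightarrow> real \<Rightarrow> bool" where
  "velocity_threshold g f w \<longleftrightarrow>
     w > 0 \<and> (\<forall>t0 v0. v0 > w \<longrightarrow> (\<exists>!t1. next_impact g f t0 v0 t1))"

text \<open>The description operator is meaningful only where the next impact time is unique, in
  particular for velocities above a threshold; orbits are required to stay there.\<close>

definition impact_map :: "real \<Rightarrow> (real \<Rightarrow> real) \<Rightarrow> real \<times> real \<Rightarrow> real \<times> real" where
  "impact_map g f = (\<lambda>(t0, v0).
     let t1 = (THE t1. next_impact g f t0 v0 t1)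
     in (t1, v0 + 2 * deriv f t1 - 2 * divdiff f t1 t0))"

definition impact_orbit ::
    "real \<Rightarrow> (real \<Rightarrow> real) \<Rightarrow> real \<Rightarrow> (nat \<Rightarrow> real) \<Rightarrow> (nat \<Rightarrow> real) \<Rightarrow> bool" where
  "impact_orbit g f w t v \<longleftrightarrow>
     (\<forall>n. v n > w) \<and> (\<forall>n. (t (Suc n), v (Suc n)) = impact_map g f (t n, v n))"

lemma C1_periodic_deriv_bounded:
  assumes "f \<in> C1_periodic"
  obtains D L where "\<And>x. (f has_real_derivative D x) (at x)" "L > 0" "\<And>x. \<bar>D x\<bar> \<le> L"
proof -
  from assms have per: "\<And>x. f (x + 1) = f x"
    and C1: "f C1_differentiable_on UNIV"
    by (auto simp: C1_periodic_def)
  from C1 obtain D where D: "\<And>x. (f has_real_derivative D x) (at x)"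
    and cont: "continuous_on UNIV D"
    by (auto simp: C1_differentiable_on_def has_real_derivative_iff_has_vector_derivative)
  have Dper: "D (x + 1) = D x" for x
  proof -
    have "((\<lambda>y. f (y + 1)) has_real_derivative D (x + 1)) (at x)"
      using D[of "x + 1"] DERIV_shift by blast
    then show ?thesis
      using D[of x] DERIV_unique per by (simp add: per)
  qed
  interpret periodic_fun_simple' D
    by standard (rule Dper)
  have "compact (D ` {0..1})"
    by (intro compact_continuous_image continuous_on_subset[OF cont]) auto
  then obtain L where L: "L > 0" "\<And>x. x \<in> {0..1} \<Longrightarrow> \<bar>D x\<bar> \<le> L"
    by (metis compact_imp_bounded bounded_pos imageI real_norm_def)
  have "\<bar>D x\<bar> \<le> L" for x
  proof -
    have "D x = D (frac x + of_int \<lfloor>x\<rfloor>)" by (simp add: frac_def)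
    also have "\<dots> = D (frac x)" by (rule plus_of_int)
    finally show ?thesis
      using L(2)[of "frac x"] by (simp add: frac_ge_0 frac_lt_1 less_imp_le)
  qed
  with D L(1) show thesis by (rule that)
qed

lemma ex_velocity_threshold:
  assumes "g > 0" "f \<in> C1_periodic"
  shows "\<exists>w. velocity_threshold g f w"
proof -
  from assms(2) obtain D L where D: "\<And>x. (f has_real_derivative D x) (at x)"
    and L: "L > 0" "\<And>x. \<bar>D x\<bar> \<le> L"
    by (rule C1_periodic_deriv_bounded) blast
  have lip: "\<bar>f (t + s) - f t\<bar> \<le> L * s" if "s > 0" for t s
  proof -
    have "\<exists>z>t. z < t + s \<and> f (t + s) - f t = (t + s - t) * D z"
      using that by (intro MVT2 D) auto
    then obtain z where "f (t + s) - f t = s * D z" by auto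
    then show ?thesis
      using L(2)[of z] that by (simp add: abs_mult mult.commute)
  qed
  have "\<exists>!t1. next_impact g f t0 v0 t1" if v0: "v0 > 3 * L" for t0 v0
  proof -
    define G where "G s = g / 2 * s\<^sup>2 - v0 * s + (f (t0 + s) - f t0)" for s
    have G_eq: "G s = s * (g / 2 * s - v0) + (f (t0 + s) - f t0)" for s
      by (simp add: G_def algebra_simps power2_eq_square)
    have impact: "next_impact g f t0 v0 (t0 + s) \<longleftrightarrow> s > 0 \<and> G s = 0" for s
    proof (cases "s > 0")
      case True
      define d where "d = (f (t0 + s) - f t0) / s"
      have sd: "f (t0 + s) - f t0 = s * d" using True by (simp add: d_def)
      have "G s = s * (g / 2 * s - v0 + d)"
        unfolding G_def sd by (simp add: algebra_simps power2_eq_square)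
      moreover have "t0 + s = t0 + (2 / g) * v0 - (2 / g) * d \<longleftrightarrow> g / 2 * s - v0 + d = 0"
      proof -
        have "t0 + s - (t0 + (2 / g) * v0 - (2 / g) * d) = (2 / g) * (g / 2 * s - v0 + d)"
          using assms(1) by (simp add: algebra_simps)
        then show ?thesis
          using assms(1) by (metis divide_eq_0_iff eq_iff_diff_eq_0 less_irrefl mult_eq_0_iff zero_neq_numeral)
      qed
      ultimately show ?thesis
        using True by (simp add: next_impact_def divdiff_def flip: d_def)
    qed (simp add: next_impact_def)
    have G': "(G has_real_derivative g * s - v0 + D (t0 + s)) (at s)" for s
      unfolding G_def
      by (auto intro!: derivative_eq_intros DERIV_chain2[OF D])
    have pos: "g * s - v0 + D (t0 + s) > 0" if "s \<ge> 2 / g * (v0 - L)" for s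
    proof -
      have "g * s \<ge> 2 * v0 - 2 * L" using that assms(1) by (simp add: field_simps)
      moreover have "D (t0 + s) \<ge> - L" using L(2)[of "t0 + s"] by (simp add: abs_le_iff)
      ultimately show ?thesis using v0 by simp
    qed
    have lower: "s \<ge> 2 / g * (v0 - L)" if "s > 0" "G s = 0" for s
    proof -
      have "s * (g / 2 * s - v0 + L) \<ge> 0"
        using lip[OF that(1), of t0] that(2) by (simp add: G_def algebra_simps power2_eq_square)
      then have "g / 2 * s - v0 + L \<ge> 0" using that(1) by (simp add: zero_le_mult_iff)
      then show ?thesis using assms(1) by (simp add: field_simps)
    qed
    let ?a = "2 / g * (v0 - L)" and ?b = "2 / g * (v0 + L)"
    have ab: "0 < ?a" "?a \<le> ?b"
      using assms(1) v0 L(1) by (auto simp: field_simps)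
    have "G s \<le> 0" if "s > 0" "g / 2 * s - v0 = - L" for s
      using G_eq[of s] lip[OF that(1), of t0] unfolding that(2) by (simp add: abs_le_iff mult.commute)
    moreover have "g / 2 * ?a - v0 = - L" using assms(1) by (simp add: field_simps)
    ultimately have "G ?a \<le> 0" using ab(1) by blast
    moreover have "G ?b \<ge> 0"
    proof -
      have "G s \<ge> 0" if "s > 0" "g / 2 * s - v0 = L" for s
        using G_eq[of s] lip[OF that(1), of t0] unfolding that(2) by (simp add: abs_le_iff mult.commute)
      moreover have "g / 2 * ?b - v0 = L" using assms(1) by (simp add: field_simps)
      moreover have "?b > 0" using ab by linarith
      ultimately show ?thesis by blast
    qed
    moreover have "continuous_on {?a..?b} G"
      using G' DERIV_isCont by (blast intro: continuous_at_imp_continuous_on)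
    ultimately obtain s where s: "?a \<le> s" "G s = 0"
      using IVT'[of G ?a 0 ?b] ab by auto
    have less: False if "x < y" "x > 0" "y > 0" "G x = 0" "G y = 0" for x y
    proof -
      have "G x < G y"
      proof (rule DERIV_pos_imp_increasing[OF that(1)])
        fix z assume "x \<le> z" "z \<le> y"
        with lower[OF that(2,4)] have "z \<ge> ?a" by linarith
        then show "\<exists>d. (G has_real_derivative d) (at z) \<and> d > 0"
          using G' pos by blast
      qed
      with that show False by simp
    qed
    show ?thesis
    proof (rule ex1I[of _ "t0 + s"])
      show "next_impact g f t0 v0 (t0 + s)" using impact s ab by simp
    next
      fix t1 assume "next_impact g f t0 v0 t1"
      then have "t1 - t0 > 0" "G (t1 - t0) = 0" using impact[of "t1 - t0"] by simp_all
      then have "t1 - t0 = s"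
        using less[of s "t1 - t0"] less[of "t1 - t0" s] s ab by (meson linorder_neqE less_le_trans)
      then show "t1 = t0 + s" by simp
    qed
  qed
  then show ?thesis
    using L(1) unfolding velocity_threshold_def by (intro exI[of _ "3 * L"]) auto
qed

end

theory Submission
  imports Defs
begin

text \<open>
  If the plate has height \<open>0\<close> at every impact of an orbit, then all divided differences
  along the orbit vanish, and with \<open>u = 2 v / g\<close> the impact map becomes a standard map,
  \<open>t' = t + u\<close> and \<open>u' = u + (4 / g) * deriv f t'\<close>. A plate whose slope at
  all these impacts is \<open>g / (2 N)\<close> therefore adds exactly \<open>2 / N\<close> to \<open>u\<close> each
  time. Starting at \<open>t = 0\<close> with an integer \<open>u = m\<close>, the impact times are
  \<open>n * m + n * (n - 1) / N\<close>, all of which lie on the grid of integer multiples of \<open>1 / N\<close>.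

  So it suffices to have a \<open>1\<close>-periodic function vanishing on this grid with slope
  \<open>g / (2 N)\<close> there, and nowhere steeper: a sine of frequency \<open>N\<close> does this. After \<open>N\<close>
  impacts \<open>u\<close> has grown by \<open>2\<close> and the phase has returned exactly. Because the cancellation is
  exact and not asymptotic, \<open>m\<close> may be as large as any velocity threshold demands.
  Finally \<open>g / (2 N) \<le> \<delta>\<close> for \<open>N = \<lceil>g / (2 \<delta>)\<rceil>\<close>, which is of order \<open>1 / \<delta>\<close>.

  The increment \<open>2 / N\<close> is preferred to \<open>1 / N\<close> because \<open>n * (n - 1) / N\<close>, unlike half of it,
  is \<open>N\<close>-periodic modulo \<open>1\<close> for \<open>N\<close> of either parity.
\<close>

definition grid_plate :: "real \<Rightarrow> nat \<Rightarrow> real \<Rightarrow> real" where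
  "grid_plate a N x = a / (2 * pi * real N) * sin (2 * pi * real N * x)"

lemma grid_plate_has_derivative:
  assumes "N > 0"
  shows "(grid_plate a N has_real_derivative a * cos (2 * pi * real N * x)) (at x)"
  unfolding grid_plate_def using assms
  by (auto intro!: derivative_eq_intros simp: field_simps)

lemma deriv_grid_plate:
  assumes "N > 0"
  shows "deriv (grid_plate a N) x = a * cos (2 * pi * real N * x)"
  using grid_plate_has_derivative[OF assms] by (rule DERIV_imp_deriv)

lemma grid_plate_C1_periodic:
  assumes "N > 0"
  shows "grid_plate a N \<in> C1_periodic"
proof -
  have "grid_plate a N (x + 1) = grid_plate a N x" for x
  proof -
    have "sin (2 * pi * real N * (x + 1)) = sin (2 * pi * real N * x + 2 * pi * of_int (int N))"
      by (simp add: algebra_simps)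
    also have "\<dots> = sin (2 * pi * real N * x)"
      unfolding sin_add by (simp add: sin_int_2pin cos_int_2pin del: of_int_of_nat_eq)
    finally show ?thesis by (simp add: grid_plate_def)
  qed
  moreover have "grid_plate a N C1_differentiable_on UNIV"
    unfolding C1_differentiable_on_def
    using grid_plate_has_derivative[OF assms, of a]
    by (intro exI[of _ "\<lambda>x. a * cos (2 * pi * real N * x)"])
       (auto simp: has_real_derivative_iff_has_vector_derivative intro!: continuous_intros)
  ultimately show ?thesis by (simp add: C1_periodic_def)
qed

lemma grid_plate_slope_bound:
  assumes "N > 0" "a \<ge> 0"
  shows "(SUP s\<in>{0..1}. \<bar>deriv (grid_plate a N) s\<bar>) \<le> a"
  using assms
  by (intro cSUP_least) (auto simp: deriv_grid_plate abs_mult intro!: mult_left_le)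

lemma grid_plate_at_grid:
  assumes "N > 0" "real N * x = of_int k"
  shows "grid_plate a N x = 0" "deriv (grid_plate a N) x = a"
proof -
  have "2 * pi * real N * x = 2 * pi * of_int k"
    using assms(2) by (simp add: mult.assoc)
  then show "grid_plate a N x = 0" "deriv (grid_plate a N) x = a"
    by (simp_all only: grid_plate_def deriv_grid_plate[OF assms(1)] sin_int_2pin cos_int_2pin mult_1_right mult_zero_right)
qed

text \<open>Impacts at equal plate heights cost no divided difference, so the ball is in the air for
  exactly \<open>(2 / g) * v\<close>; the threshold enters only to make this the value of the
  description operator.\<close>

lemma impact_map_equal_heights:
  assumes "g > 0" "velocity_threshold g f w" "v > w"
    and same_height: "f (t + 2 / g * v) = f t"
  shows "impact_map g f (t, v) = (t + 2 / g * v, v + 2 * deriv f (t + 2 / g * v))"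
proof -
  let ?t' = "t + 2 / g * v"
  have "\<exists>!t1. next_impact g f t v t1" and "v > 0"
    using assms(2,3) by (auto simp: velocity_threshold_def)
  moreover have no_diff: "divdiff f ?t' t = 0"
    using same_height by (simp add: divdiff_def)
  moreover have "next_impact g f t v ?t'"
    using \<open>v > 0\<close> assms(1) no_diff by (simp add: next_impact_def)
  ultimately have "(THE t1. next_impact g f t v t1) = ?t'"
    by (intro the1_equality)
  then show ?thesis using no_diff by (simp add: impact_map_def Let_def)
qed

definition grid_time :: "nat \<Rightarrow> nat \<Rightarrow> nat \<Rightarrow> real" where
  "grid_time N m n = real n * real m + real n * (real n - 1) / real N"

definition grid_velocity :: "real \<Rightarrow> nat \<Rightarrow> nat \<Rightarrow> nat \<Rightarrow> real" where
  "grid_velocity g N m n = g / 2 * (real m + 2 * real n / real N)"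

lemma grid_time_on_grid:
  assumes "N > 0"
  shows "real N * grid_time N m n = of_int (int n * int m * int N + int n * (int n - 1))"
  using assms by (simp add: grid_time_def field_simps)

lemma grid_time_Suc:
  assumes "g > 0" "N > 0"
  shows "grid_time N m (Suc n) = grid_time N m n + 2 / g * grid_velocity g N m n"
  using assms by (simp add: grid_time_def grid_velocity_def field_simps)

lemma grid_time_period:
  assumes "N > 0"
  shows "grid_time N m (n + N) = grid_time N m n + real (N * m + 2 * n + (N - 1))"
  using assms by (simp add: grid_time_def field_simps of_nat_diff)

lemma grid_velocity_period:
  assumes "N > 0"
  shows "grid_velocity g N m (n + N) = grid_velocity g N m n + g / 2 * real (2::nat)"
  using assms by (simp add: grid_velocity_def field_simps)

lemma grid_orbit:
  assumes "g > 0" "N > 0"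
    and threshold: "velocity_threshold g (grid_plate (g / (2 * real N)) N) w"
    and fast: "g / 2 * real m > w"
  shows "impact_orbit g (grid_plate (g / (2 * real N)) N) w
           (grid_time N m) (grid_velocity g N m)"
  unfolding impact_orbit_def
proof (intro conjI allI)
  let ?f = "grid_plate (g / (2 * real N)) N"
  fix n
  have "g / 2 * real m \<le> grid_velocity g N m n"
    using assms(1) by (simp add: grid_velocity_def distrib_left)
  then show above: "grid_velocity g N m n > w" using fast by simp
  note at_grid = grid_plate_at_grid[OF assms(2) grid_time_on_grid[OF assms(2)]]
  have velocity_Suc:
    "grid_velocity g N m (Suc n) = grid_velocity g N m n + 2 * (g / (2 * real N))"
    using assms(2) by (simp add: grid_velocity_def field_simps)
  have "?f (grid_time N m n + 2 / g * grid_velocity g N m n) = ?f (grid_time N m n)"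
    unfolding grid_time_Suc[OF assms(1,2), symmetric] by (simp only: at_grid)
  from impact_map_equal_heights[OF assms(1) threshold above this]
  show "(grid_time N m (Suc n), grid_velocity g N m (Suc n))
          = impact_map g ?f (grid_time N m n, grid_velocity g N m n)"
    unfolding grid_time_Suc[OF assms(1,2), symmetric]
    by (simp only: at_grid velocity_Suc)
qed

theorem theorem1:
  fixes g :: real
  assumes "g > 0"
  shows "\<exists>c C :: real. 0 < c \<and> c \<le> C \<and>
    (\<forall>vbar :: (real \<Rightarrow> real) \<Rightarrow> real.
      (\<forall>f \<in> C1_periodic. velocity_threshold g f (vbar f)) \<longrightarrow>
      (\<forall>\<delta> :: real. 0 < \<delta> \<and> \<delta> < g / 4 \<longrightarrow>
        (\<exists>f \<in> C1_periodic. \<exists>(t0 :: real) (v0 :: real) (N :: nat) (V :: nat).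
           N \<ge> 1 \<and> c / \<delta> \<le> real N \<and> real N \<le> C / \<delta> \<and> V \<noteq> 0 \<and>
           (SUP s\<in>{0..1}. \<bar>deriv f s\<bar>) \<le> \<delta> \<and>
           (\<exists>t v. t 0 = t0 \<and> v 0 = v0 \<and> impact_orbit g f (vbar f) t v \<and>
             (\<forall>n. (\<exists>\<sigma> :: nat. t (n + N) = t n + real \<sigma>) \<and>
                  v (n + N) = v n + g / 2 * real V)))))"
proof (intro exI conjI allI impI)
  show "0 < g / 2" "g / 2 \<le> 3 * g / 4" using assms by simp_all
next
  fix vbar :: "(real \<Rightarrow> real) \<Rightarrow> real" and \<delta> :: real
  assume vbar: "\<forall>f\<in>C1_periodic. velocity_threshold g f (vbar f)"
    and \<delta>: "0 < \<delta> \<and> \<delta> < g / 4"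
  define N where "N = nat \<lceil>g / (2 * \<delta>)\<rceil>"
  have "g / (2 * \<delta>) > 0" using assms \<delta> by simp
  then have lower: "g / (2 * \<delta>) \<le> real N" and upper: "real N < g / (2 * \<delta>) + 1"
    unfolding N_def by linarith+
  then have N: "N > 0" using \<open>g / (2 * \<delta>) > 0\<close> by (cases N) simp_all
  \<comment> \<open>The rounding error \<open>1\<close> is absorbed into the upper constant by \<open>\<delta> < g / 4\<close>.\<close>
  have "1 < g / (4 * \<delta>)" using \<delta> by (simp add: field_simps)
  then have upper': "real N \<le> 3 * g / 4 / \<delta>"
    using upper \<delta> by (simp add: field_simps)
  define f where "f = grid_plate (g / (2 * real N)) N"
  have f: "f \<in> C1_periodic" unfolding f_def by (rule grid_plate_C1_periodic[OF N])
  have "(SUP s\<in>{0..1}. \<bar>deriv f s\<bar>) \<le> g / (2 * real N)"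
    unfolding f_def using assms by (intro grid_plate_slope_bound[OF N]) simp
  also have "\<dots> \<le> \<delta>" using lower N \<delta> by (simp add: field_simps)
  finally have slope: "(SUP s\<in>{0..1}. \<bar>deriv f s\<bar>) \<le> \<delta>" .
  obtain m :: nat where "real m > vbar f / (g / 2)" using reals_Archimedean2 by blast
  then have "g / 2 * real m > vbar f" using assms by (simp add: field_simps)
  then have orbit: "impact_orbit g f (vbar f) (grid_time N m) (grid_velocity g N m)"
    using grid_orbit[OF assms N] vbar f unfolding f_def by blast
  show "\<exists>f \<in> C1_periodic. \<exists>(t0 :: real) (v0 :: real) (N :: nat) (V :: nat).
           N \<ge> 1 \<and> g / 2 / \<delta> \<le> real N \<and> real N \<le> 3 * g / 4 / \<delta> \<and> V \<noteq> 0 \<and>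
           (SUP s\<in>{0..1}. \<bar>deriv f s\<bar>) \<le> \<delta> \<and>
           (\<exists>t v. t 0 = t0 \<and> v 0 = v0 \<and> impact_orbit g f (vbar f) t v \<and>
             (\<forall>n. (\<exists>\<sigma> :: nat. t (n + N) = t n + real \<sigma>) \<and>
                  v (n + N) = v n + g / 2 * real V))"
  proof (intro bexI[OF _ f] exI conjI allI)
    show "N \<ge> 1" using N by simp
    show "g / 2 / \<delta> \<le> real N" using lower by simp
    show "real N \<le> 3 * g / 4 / \<delta>" by (rule upper')
    show "(2::nat) \<noteq> 0" by simp
    show "(SUP s\<in>{0..1}. \<bar>deriv f s\<bar>) \<le> \<delta>" by (rule slope)
    show "impact_orbit g f (vbar f) (grid_time N m) (grid_velocity g N m)" by (rule orbit)
    show "grid_time N m (n + N) = grid_time N m n + real (N * m + 2 * n + (N - 1))" for n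
      by (rule grid_time_period[OF N])
    show "grid_velocity g N m (n + N) = grid_velocity g N m n + g / 2 * real (2::nat)" for n
      by (rule grid_velocity_period[OF N])
  qed (rule refl)+
qed

end
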